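(* Let $F$ be an algebraically closed field. If $p, g \in F[x_1,x_2,\ldots,x_n]$ have the same zero set in $F^n$, then $p$ and $g$ have a common factor in $F[x_1,\ldots,x_n]$ with the same zero set as $p$ and $g$.
   Context: The zero set of $f\in F[x_1,\ldots,x_n]$ is $\{a\in F^n : f(a)=0\}$. A common factor of $p$ and $g$ is a polynomial in $F[x_1,\ldots,x_n]$ dividing both $p$ and $g$. *)

theory Defs
  imports
    "HOL-Library.Poly_Mapping"
    "HOL-Computational_Algebra.Computational_Algebra"
    "HOL-Analysis.Finite_Cartesian_Product"
begin

text \<open>
  Polynomials over \<open>'a\<close> in the variables indexed by \<open>'n\<close>: finitely supported maps from
  exponent vectors to coefficients. Their multiplication in \<open>Poly_Mapping\<close> is convolution, so
  \<open>dvd\<close> on this type is divisibility in the polynomial ring.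
\<close>

type_synonym ('a, 'n) mpoly = "('n \<Rightarrow>\<^sub>0 nat) \<Rightarrow>\<^sub>0 'a"

definition mpoly_eval :: "('a::comm_semiring_1, 'n::finite) mpoly \<Rightarrow> 'a ^ 'n \<Rightarrow> 'a" where
  "mpoly_eval p a =
     (\<Sum>m\<in>Poly_Mapping.keys p.
        Poly_Mapping.lookup p m * (\<Prod>i\<in>UNIV. (a $ i) ^ Poly_Mapping.lookup m i))"

definition zero_set :: "('a::comm_semiring_1, 'n::finite) mpoly \<Rightarrow> ('a ^ 'n) set" where
  "zero_set p = {a. mpoly_eval p a = 0}"

end

theory Submission
  imports Defs
begin

text \<open>
  The common factor is essentially the radical of \<open>p\<close>. An irreducible factor \<open>q\<close> of \<open>p\<close> has its zeros
  among those of \<open>g\<close>, and then \<open>q\<close> divides \<open>g\<close>: choose a variable \<open>v\<close> that occurs in \<open>q\<close>. If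
  \<open>q\<close> does not divide \<open>g\<close>, Gauss's lemma yields a polynomial \<open>c = u q + w g \<noteq> 0\<close> without \<open>v\<close>. At a
  point where neither \<open>c\<close> nor the leading coefficient of \<open>q\<close> with respect to \<open>v\<close> vanishes, the
  coordinate \<open>v\<close> can be changed so that \<open>q\<close> vanishes; there \<open>g\<close> vanishes as well and \<open>c\<close> does
  not, a contradiction. The same dichotomy shows, by induction on the number of variables, that
  irreducible polynomials are prime.

  The argument is carried out with variables indexed by \<open>nat\<close>: there the induction can range over
  finite sets of variables, and the polynomials are an instance of \<open>idom\<close>, which for exponent
  vectors over \<open>'n\<close> would require a linear order on \<open>'n\<close>.
\<close>

section \<open>Ring homomorphisms on polynomials\<close>

definition ring_map :: "('b::comm_semiring_1 \<Rightarrow> 'c::comm_semiring_1) \<Rightarrow> bool" where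
  "ring_map f \<longleftrightarrow> f 0 = 0 \<and> f 1 = 1 \<and> (\<forall>x y. f (x + y) = f x + f y) \<and> (\<forall>x y. f (x * y) = f x * f y)"

lemma ring_mapI:
  assumes "f 0 = 0" "f 1 = 1" "\<And>x y. f (x + y) = f x + f y" "\<And>x y. f (x * y) = f x * f y"
  shows "ring_map f"
  using assms by (simp add: ring_map_def)

lemma ring_mapD:
  assumes "ring_map f"
  shows "f 0 = 0" "f 1 = 1" "f (x + y) = f x + f y" "f (x * y) = f x * f y"
  using assms by (simp_all add: ring_map_def)

lemma ring_map_sum:
  assumes "ring_map f"
  shows "f (sum g A) = (\<Sum>i\<in>A. f (g i))"
  by (induction A rule: infinite_finite_induct) (simp_all add: ring_mapD[OF assms])

lemma ring_map_uminus:
  fixes f :: "'b::comm_ring_1 \<Rightarrow> 'c::comm_ring_1"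
  assumes "ring_map f"
  shows "f (- x) = - f x"
  using ring_mapD(3)[OF assms, of x "- x"] ring_mapD(1)[OF assms] by (simp add: eq_neg_iff_add_eq_0 add.commute)

lemma ring_map_dvd: "ring_map f \<Longrightarrow> a dvd b \<Longrightarrow> f a dvd f b"
  by (auto simp: ring_mapD(4) elim!: dvdE)

lemma ring_map_id [intro]: "ring_map (\<lambda>x. x)"
  by (simp add: ring_map_def)

lemma ring_map_comp: "ring_map f \<Longrightarrow> ring_map g \<Longrightarrow> ring_map (\<lambda>x. f (g x))"
  by (simp add: ring_map_def)

lemma ring_map_poly: "ring_map (\<lambda>p. poly p x)"
  by (rule ring_mapI) simp_all

lemma ring_map_const_poly: "ring_map (\<lambda>a. [:a:])"
  by (rule ring_mapI) (simp_all add: one_pCons mult.commute)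

lemma ring_map_map_poly:
  assumes "ring_map f"
  shows "ring_map (map_poly f)"
proof (rule ring_mapI)
  fix p q :: "'a poly"
  note [simp] = ring_mapD[OF assms]
  show "map_poly f (p + q) = map_poly f p + map_poly f q"
    by (rule poly_eqI) (simp add: coeff_map_poly)
  show "map_poly f (p * q) = map_poly f p * map_poly f q"
    by (rule poly_eqI) (simp add: coeff_map_poly coeff_mult ring_map_sum[OF assms])
qed (simp_all add: ring_mapD[OF assms])

section \<open>Generators and substitution homomorphisms\<close>

lemma sum_single_lookup:
  "(\<Sum>k\<in>Poly_Mapping.keys p. Poly_Mapping.single k (Poly_Mapping.lookup p k)) = p"
  by (rule poly_mapping_eqI)
     (auto simp: lookup_sum lookup_single when_def sum.delta not_in_keys_iff_lookup_eq_zero)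

definition Const :: "'b::comm_semiring_1 \<Rightarrow> ('v \<Rightarrow>\<^sub>0 nat) \<Rightarrow>\<^sub>0 'b" where
  "Const a = Poly_Mapping.single 0 a"

definition Var :: "'v \<Rightarrow> ('v \<Rightarrow>\<^sub>0 nat) \<Rightarrow>\<^sub>0 'b::comm_semiring_1" where
  "Var i = Poly_Mapping.single (Poly_Mapping.single i 1) 1"

lemma ring_map_Const: "ring_map Const"
  by (rule ring_mapI) (simp_all add: Const_def single_add mult_single)

text \<open>Powers of one variable are built first, then monomials, terms and sums of terms.
  \<open>sum_single_lookup\<close> splits both an exponent vector and a polynomial.\<close>

lemma mpoly_induct [case_names Const Var add mult]:
  fixes p :: "('v \<Rightarrow>\<^sub>0 nat) \<Rightarrow>\<^sub>0 'b::comm_semiring_1"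
  assumes C: "\<And>a. P (Const a)" and V: "\<And>i. P (Var i)"
    and add: "\<And>p q. P p \<Longrightarrow> P q \<Longrightarrow> P (p + q)" and mult: "\<And>p q. P p \<Longrightarrow> P q \<Longrightarrow> P (p * q)"
  shows "P p"
proof -
  have power_var: "P (Poly_Mapping.single (Poly_Mapping.single i n) 1)" for i n
  proof (induction n)
    case 0
    show ?case using C[of 1] by (simp add: Const_def)
  next
    case (Suc n)
    have "Poly_Mapping.single (Poly_Mapping.single i (Suc n)) (1::'b)
        = Var i * Poly_Mapping.single (Poly_Mapping.single i n) 1"
      by (simp add: Var_def mult_single flip: single_add)
    with mult[OF V Suc] show ?case by simp
  qed
  have monomial: "P (Poly_Mapping.single (\<Sum>i\<in>A. Poly_Mapping.single i (g i)) 1)"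
    if "finite A" for A and g :: "'v \<Rightarrow> nat"
    using that
  proof (induction A rule: finite_induct)
    case empty
    show ?case using C[of 1] by (simp add: Const_def)
  next
    case (insert i A)
    then show ?case
      using mult[OF power_var[of i "g i"] insert.IH] by (simp add: mult_single)
  qed
  have single: "P (Poly_Mapping.single m a)" for m a
  proof -
    have "P (Poly_Mapping.single m 1)"
      using monomial[of "Poly_Mapping.keys m" "Poly_Mapping.lookup m"] by (simp add: sum_single_lookup)
    from mult[OF C[of a] this] show ?thesis
      by (simp add: Const_def mult_single)
  qed
  have "P (\<Sum>m\<in>A. Poly_Mapping.single m (h m))" if "finite A" for A h
    using that
  proof (induction A rule: finite_induct)
    case empty
    show ?case using C[of 0] by (simp add: Const_def)
  next
    case (insert m A)
    then show ?case using add[OF single insert.IH] by simp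
  qed
  from this[of "Poly_Mapping.keys p" "Poly_Mapping.lookup p"] show ?thesis
    by (simp add: sum_single_lookup)
qed

text \<open>Most identities between \<open>as_poly\<close>, \<open>kill\<close> and evaluations are
  proved below by comparing homomorphisms on generators.\<close>

lemma ring_map_eqI:
  fixes f g :: "(('v \<Rightarrow>\<^sub>0 nat) \<Rightarrow>\<^sub>0 'b::comm_semiring_1) \<Rightarrow> 'c::comm_semiring_1"
  assumes "ring_map f" "ring_map g" "\<And>a. f (Const a) = g (Const a)" "\<And>i. f (Var i) = g (Var i)"
  shows "f p = g p"
  by (induction p rule: mpoly_induct) (simp_all add: assms ring_mapD[OF assms(1)] ring_mapD[OF assms(2)])

text \<open>For a homomorphism \<open>c\<close>, this is the map given by the universal property of
  the polynomial ring.\<close>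

definition mpoly_subst ::
    "('b::comm_semiring_1 \<Rightarrow> 'c::comm_semiring_1) \<Rightarrow> ('v \<Rightarrow> 'c) \<Rightarrow> (('v \<Rightarrow>\<^sub>0 nat) \<Rightarrow>\<^sub>0 'b) \<Rightarrow> 'c" where
  "mpoly_subst c f p = (\<Sum>m\<in>Poly_Mapping.keys p. c (Poly_Mapping.lookup p m) *
      (\<Prod>i\<in>Poly_Mapping.keys m. f i ^ Poly_Mapping.lookup m i))"

text \<open>All three products are taken over the union of the supports, where an exponent 0
  contributes the factor 1.\<close>

lemma prod_keys_add:
  fixes f :: "'v \<Rightarrow> 'c::comm_semiring_1" and m n :: "'v \<Rightarrow>\<^sub>0 nat"
  shows "(\<Prod>i\<in>Poly_Mapping.keys (m + n). f i ^ Poly_Mapping.lookup (m + n) i) =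
     (\<Prod>i\<in>Poly_Mapping.keys m. f i ^ Poly_Mapping.lookup m i) *
     (\<Prod>i\<in>Poly_Mapping.keys n. f i ^ Poly_Mapping.lookup n i)"
proof -
  let ?A = "Poly_Mapping.keys m \<union> Poly_Mapping.keys n"
  have superset: "(\<Prod>i\<in>Poly_Mapping.keys k. f i ^ Poly_Mapping.lookup k i)
      = (\<Prod>i\<in>?A. f i ^ Poly_Mapping.lookup k i)" if "Poly_Mapping.keys k \<subseteq> ?A" for k
    using that by (intro prod.mono_neutral_left) (auto simp: not_in_keys_iff_lookup_eq_zero)
  show ?thesis
    unfolding superset[OF Poly_Mapping.keys_add] superset[OF Un_upper1] superset[OF Un_upper2]
    by (simp add: lookup_add power_add prod.distrib)
qed

context
  fixes c :: "'b::comm_semiring_1 \<Rightarrow> 'c::comm_semiring_1" and f :: "'v \<Rightarrow> 'c"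
  assumes c: "ring_map c"
begin

lemma mpoly_subst_superset:
  assumes "finite A" "Poly_Mapping.keys p \<subseteq> A"
  shows "mpoly_subst c f p = (\<Sum>m\<in>A. c (Poly_Mapping.lookup p m) *
      (\<Prod>i\<in>Poly_Mapping.keys m. f i ^ Poly_Mapping.lookup m i))"
  unfolding mpoly_subst_def using assms
  by (intro sum.mono_neutral_left) (auto simp: not_in_keys_iff_lookup_eq_zero ring_mapD[OF c])

lemma mpoly_subst_add: "mpoly_subst c f (p + q) = mpoly_subst c f p + mpoly_subst c f q"
proof -
  let ?A = "Poly_Mapping.keys p \<union> Poly_Mapping.keys q"
  have "Poly_Mapping.keys (p + q) \<subseteq> ?A"
    by (rule Poly_Mapping.keys_add)
  then show ?thesis
    by (simp add: mpoly_subst_superset[of ?A] lookup_add ring_mapD[OF c] sum.distrib distrib_right)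
qed

lemma mpoly_subst_single:
  "mpoly_subst c f (Poly_Mapping.single m a) =
     c a * (\<Prod>i\<in>Poly_Mapping.keys m. f i ^ Poly_Mapping.lookup m i)"
  by (subst mpoly_subst_superset[of "{m}"]) auto

lemma ring_map_mpoly_subst: "ring_map (mpoly_subst c f)"
proof (rule ring_mapI)
  show zero: "mpoly_subst c f 0 = 0"
    by (simp add: mpoly_subst_def)
  show "mpoly_subst c f 1 = 1"
    using mpoly_subst_single[of 0 1] by (simp add: ring_mapD[OF c])
  show "mpoly_subst c f (p + q) = mpoly_subst c f p + mpoly_subst c f q" for p q
    by (rule mpoly_subst_add)
  fix p q :: "('v \<Rightarrow>\<^sub>0 nat) \<Rightarrow>\<^sub>0 'b"
  have sum_hom: "mpoly_subst c f (sum h A) = (\<Sum>i\<in>A. mpoly_subst c f (h i))"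
    for h and A :: "('v \<Rightarrow>\<^sub>0 nat) set"
    by (induction A rule: infinite_finite_induct) (simp_all add: zero mpoly_subst_add)
  \<comment> \<open>Expanding both factors reduces multiplicativity to single terms, without
    unfolding the convolution.\<close>
  have "p * q = (\<Sum>m\<in>Poly_Mapping.keys p. Poly_Mapping.single m (Poly_Mapping.lookup p m)) *
      (\<Sum>n\<in>Poly_Mapping.keys q. Poly_Mapping.single n (Poly_Mapping.lookup q n))"
    by (simp add: sum_single_lookup)
  also have "\<dots> = (\<Sum>m\<in>Poly_Mapping.keys p. \<Sum>n\<in>Poly_Mapping.keys q.
      Poly_Mapping.single (m + n) (Poly_Mapping.lookup p m * Poly_Mapping.lookup q n))"
    by (simp add: sum_product mult_single)
  finally have "mpoly_subst c f (p * q) = (\<Sum>m\<in>Poly_Mapping.keys p. \<Sum>n\<in>Poly_Mapping.keys q.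
      mpoly_subst c f (Poly_Mapping.single (m + n) (Poly_Mapping.lookup p m * Poly_Mapping.lookup q n)))"
    by (simp add: sum_hom)
  also have "\<dots> = mpoly_subst c f p * mpoly_subst c f q"
    unfolding mpoly_subst_single prod_keys_add
    by (simp add: mpoly_subst_def ring_mapD[OF c] sum_product mult_ac)
  finally show "mpoly_subst c f (p * q) = mpoly_subst c f p * mpoly_subst c f q" .
qed

lemma mpoly_subst_Const [simp]: "mpoly_subst c f (Const a) = c a"
  by (simp add: Const_def mpoly_subst_single)

lemma mpoly_subst_Var [simp]: "mpoly_subst c f (Var i) = f i"
  by (simp add: Var_def mpoly_subst_single ring_mapD[OF c])

end

section \<open>Gauss's lemma relative to a subring\<close>

lemma smult_cancel:
  fixes p q :: "'b::idom poly"
  shows "smult c p = smult c q \<Longrightarrow> c \<noteq> 0 \<Longrightarrow> p = q"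
  by (simp add: poly_eq_iff)

lemma dvd_mult_unitD:
  fixes a b u :: "'b::comm_semiring_1"
  assumes "u dvd 1" "a dvd b * u"
  shows "a dvd b"
proof -
  from assms(1) obtain v where "1 = u * v" by (elim dvdE)
  then have "b = b * u * v" by (simp add: mult.assoc)
  with assms(2) show ?thesis by (metis dvd_mult2)
qed

text \<open>
  The induction on the number of variables takes place inside a single type, so Gauss's lemma is
  needed for a subring \<open>S\<close> of an integral domain. Assumption \<open>S_induct\<close> says that \<open>S\<close> is atomic.
\<close>

locale gauss_subring =
  fixes S :: "'r::idom set"
  assumes S_0: "0 \<in> S" and S_1: "1 \<in> S"
    and S_uminus: "\<And>a. a \<in> S \<Longrightarrow> - a \<in> S"
    and S_add: "\<And>a b. a \<in> S \<Longrightarrow> b \<in> S \<Longrightarrow> a + b \<in> S"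
    and S_mult: "\<And>a b. a \<in> S \<Longrightarrow> b \<in> S \<Longrightarrow> a * b \<in> S"
    and S_factor: "\<And>a b. a * b \<in> S \<Longrightarrow> a * b \<noteq> 0 \<Longrightarrow> a \<in> S"
    and S_induct: "\<And>P c. c \<in> S \<Longrightarrow> c \<noteq> 0 \<Longrightarrow> (\<And>u. u \<in> S \<Longrightarrow> u dvd 1 \<Longrightarrow> P u) \<Longrightarrow>
      (\<And>q. q \<in> S \<Longrightarrow> irreducible q \<Longrightarrow> P q) \<Longrightarrow>
      (\<And>a b. a \<in> S \<Longrightarrow> b \<in> S \<Longrightarrow> P a \<Longrightarrow> P b \<Longrightarrow> P (a * b)) \<Longrightarrow> P c"
    and S_prime: "\<And>q a b. q \<in> S \<Longrightarrow> irreducible q \<Longrightarrow> a \<in> S \<Longrightarrow> b \<in> S \<Longrightarrow>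
      q dvd a * b \<Longrightarrow> q dvd a \<or> q dvd b"
begin

text \<open>The polynomial ring over \<open>S\<close>, kept as a set because \<open>S\<close> is not
  a type.\<close>

definition SX :: "'r poly set" where
  "SX = {p. \<forall>i. coeff p i \<in> S}"

lemma S_sum: "(\<And>i. i \<in> A \<Longrightarrow> f i \<in> S) \<Longrightarrow> sum f A \<in> S"
  by (induction A rule: infinite_finite_induct) (auto intro: S_0 S_add)

lemma SX_0: "0 \<in> SX" and SX_const: "c \<in> S \<Longrightarrow> [:c:] \<in> SX"
  by (auto simp: SX_def S_0 coeff_pCons split: nat.splits)

lemma SX_uminus: "p \<in> SX \<Longrightarrow> - p \<in> SX" and SX_add: "p \<in> SX \<Longrightarrow> q \<in> SX \<Longrightarrow> p + q \<in> SX"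
  and SX_mult: "p \<in> SX \<Longrightarrow> q \<in> SX \<Longrightarrow> p * q \<in> SX"
  and SX_smult: "c \<in> S \<Longrightarrow> p \<in> SX \<Longrightarrow> smult c p \<in> SX"
  by (auto simp: SX_def S_uminus S_add S_mult coeff_mult intro: S_sum)

lemma SX_diff: "p \<in> SX \<Longrightarrow> q \<in> SX \<Longrightarrow> p - q \<in> SX"
  using SX_add[OF _ SX_uminus] by fastforce

lemma SX_monom: "c \<in> S \<Longrightarrow> monom c n \<in> SX"
  by (auto simp: SX_def S_0)

lemma SX_lead_coeff: "p \<in> SX \<Longrightarrow> lead_coeff p \<in> S"
  by (simp add: SX_def)

lemma SX_smultD:
  assumes "smult c p \<in> SX" "c \<noteq> 0"
  shows "p \<in> SX"
  unfolding SX_def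
proof safe
  fix i
  show "coeff p i \<in> S"
    using assms S_factor[of "coeff p i" c] by (cases "coeff p i = 0") (auto simp: SX_def S_0 mult.commute)
qed

text \<open>Gauss's argument: if \<open>i\<close> and \<open>j\<close> are the first indices where
  \<open>q\<close> fails to divide \<open>d\<close> and \<open>s\<close>, then in degree
  \<open>i + j\<close> every summand but one has a factor of smaller index and is divisible by
  \<open>q\<close>.\<close>

lemma irreducible_dvd_SX_mult:
  assumes "q \<in> S" "irreducible q" "d \<in> SX" "s \<in> SX" and dvd: "[:q:] dvd d * s"
  shows "[:q:] dvd d \<or> [:q:] dvd s"
proof (rule ccontr)
  assume "\<not> ?thesis"
  then have ex: "\<exists>i. \<not> q dvd coeff d i" "\<exists>i. \<not> q dvd coeff s i"
    by (auto simp: const_poly_dvd_iff)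
  define i where "i = (LEAST i. \<not> q dvd coeff d i)"
  define j where "j = (LEAST j. \<not> q dvd coeff s j)"
  have i: "\<not> q dvd coeff d i" "\<And>k. k < i \<Longrightarrow> q dvd coeff d k"
    using LeastI_ex[OF ex(1)] not_less_Least unfolding i_def by blast+
  have j: "\<not> q dvd coeff s j" "\<And>k. k < j \<Longrightarrow> q dvd coeff s k"
    using LeastI_ex[OF ex(2)] not_less_Least unfolding j_def by blast+
  have "q dvd coeff (d * s) (i + j)"
    using dvd by (auto simp: const_poly_dvd_iff)
  also have "coeff (d * s) (i + j) = (\<Sum>k\<le>i + j. coeff d k * coeff s (i + j - k))"
    by (rule coeff_mult)
  also have "\<dots> = coeff d i * coeff s j + (\<Sum>k\<in>{..i + j} - {i}. coeff d k * coeff s (i + j - k))"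
    by (subst sum.remove[of _ i]) auto
  finally have "q dvd coeff d i * coeff s j + (\<Sum>k\<in>{..i + j} - {i}. coeff d k * coeff s (i + j - k))" .
  moreover have "q dvd (\<Sum>k\<in>{..i + j} - {i}. coeff d k * coeff s (i + j - k))"
  proof (rule dvd_sum)
    fix k assume "k \<in> {..i + j} - {i}"
    then have "k < i \<or> i + j - k < j" by auto
    then show "q dvd coeff d k * coeff s (i + j - k)"
      using i(2) j(2) by auto
  qed
  ultimately have "q dvd coeff d i * coeff s j"
    by (simp add: dvd_add_left_iff)
  with S_prime[OF assms(1,2)] assms(3,4) i(1) j(1) show False
    by (auto simp: SX_def)
qed

text \<open>Clears a denominator \<open>c\<close>: its irreducible factors are cancelled one at a
  time, each against \<open>d\<close> or \<open>s\<close> by primality. This takes the place of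
  contents and greatest common divisors.\<close>

lemma gauss_strip:
  assumes "c \<in> S" "c \<noteq> 0" "q \<in> SX" "d \<in> SX" "s \<in> SX" "smult c q = d * s"
  shows "\<exists>c1 c2 d' s'. c1 \<in> S \<and> c2 \<in> S \<and> d' \<in> SX \<and> s' \<in> SX \<and> d = smult c1 d' \<and> s = smult c2 s' \<and> q = d' * s'"
proof -
  \<comment> \<open>\<open>P\<close> quantifies over \<open>q\<close>, \<open>d\<close>,
    \<open>s\<close> because the product case applies the hypothesis for \<open>b\<close> to the
    factors left after cancelling \<open>a\<close>.\<close>
  define P where "P c \<longleftrightarrow> (c \<noteq> 0 \<longrightarrow> (\<forall>q\<in>SX. \<forall>d\<in>SX. \<forall>s\<in>SX. smult c q = d * s \<longrightarrow>
    (\<exists>c1 c2 d' s'. c1 \<in> S \<and> c2 \<in> S \<and> d' \<in> SX \<and> s' \<in> SX \<and> d = smult c1 d' \<and> s = smult c2 s' \<and> q = d' * s')))" for c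
  have "P c"
  proof (rule S_induct[OF assms(1,2)])
    fix u assume u: "u \<in> S" "u dvd 1"
    then obtain v where v: "1 = u * v" by (elim dvdE)
    then have vS: "v \<in> S"
      using S_factor[of v u] S_1 by (simp add: mult.commute)
    show "P u"
      unfolding P_def
    proof (intro impI ballI exI conjI)
      fix q d s assume *: "q \<in> SX" "d \<in> SX" "s \<in> SX" "smult u q = d * s"
      show "u \<in> S" "1 \<in> S" using u S_1 by auto
      show "smult v d \<in> SX" using vS * by (intro SX_smult)
      show "s \<in> SX" by fact
      show "d = smult u (smult v d)" by (simp flip: v)
      show "s = smult 1 s" by simp
      have "q = smult (v * u) q" using v by (simp add: mult.commute)
      also have "\<dots> = smult v d * s"
        using arg_cong[OF *(4), of "smult v"] by simp
      finally show "q = smult v d * s" .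
    qed
  next
    fix r assume r: "r \<in> S" "irreducible r"
    show "P r"
      unfolding P_def
    proof (intro impI ballI)
      fix q d s assume "r \<noteq> 0" and *: "q \<in> SX" "d \<in> SX" "s \<in> SX" "smult r q = d * s"
      have "[:r:] dvd d * s"
        by (rule dvdI[of _ _ q]) (simp flip: *(4))
      then consider d' where "d = smult r d'" | s' where "s = smult r s'"
        using irreducible_dvd_SX_mult[OF r *(2,3)] by (auto elim!: dvdE)
      then show "\<exists>c1 c2 d' s'. c1 \<in> S \<and> c2 \<in> S \<and> d' \<in> SX \<and> s' \<in> SX \<and> d = smult c1 d' \<and> s = smult c2 s' \<and> q = d' * s'"
      proof cases
        case 1
        then have "smult r q = smult r (d' * s)" using * by simp
        then have "q = d' * s" using \<open>r \<noteq> 0\<close> by (metis smult_cancel)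
        then show ?thesis using 1 * SX_smultD[of r d'] \<open>r \<noteq> 0\<close>
          by (intro exI[of _ r] exI[of _ 1] exI[of _ d'] exI[of _ s]) (auto simp: r S_1)
      next
        case 2
        then have "smult r q = smult r (d * s')" using * by simp
        then have "q = d * s'" using \<open>r \<noteq> 0\<close> by (metis smult_cancel)
        then show ?thesis using 2 * SX_smultD[of r s'] \<open>r \<noteq> 0\<close>
          by (intro exI[of _ 1] exI[of _ r] exI[of _ d] exI[of _ s']) (auto simp: r S_1)
      qed
    qed
  next
    fix a b assume ab: "a \<in> S" "b \<in> S" and Pa: "P a" and Pb: "P b"
    show "P (a * b)"
      unfolding P_def
    proof (intro impI ballI)
      fix q d s assume nz: "a * b \<noteq> 0" and *: "q \<in> SX" "d \<in> SX" "s \<in> SX" "smult (a * b) q = d * s"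
      \<comment> \<open>First \<open>a\<close> is cancelled, with \<open>smult b q\<close> in place
        of \<open>q\<close>; then \<open>b\<close> is.\<close>
      have "smult b q \<in> SX" "smult a (smult b q) = d * s"
        using * ab by (auto intro: SX_smult)
      with Pa * nz obtain c1 c2 d' s' where 1: "c1 \<in> S" "c2 \<in> S" "d' \<in> SX" "s' \<in> SX" "d = smult c1 d'" "s = smult c2 s'"
        "smult b q = d' * s'"
        unfolding P_def by (metis mult_zero_left)
      with Pb * nz obtain c3 c4 d'' s'' where "c3 \<in> S" "c4 \<in> S" "d'' \<in> SX" "s'' \<in> SX" "d' = smult c3 d''" "s' = smult c4 s''"
        "q = d'' * s''"
        unfolding P_def by (metis mult_zero_right)
      with 1(1,2,5,6) show "\<exists>c1 c2 d' s'. c1 \<in> S \<and> c2 \<in> S \<and> d' \<in> SX \<and> s' \<in> SX \<and> d = smult c1 d' \<and> s = smult c2 s' \<and> q = d' * s'"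
        by (intro exI[of _ "c1 * c3"] exI[of _ "c2 * c4"] exI[of _ d''] exI[of _ s'']) (auto intro: S_mult)
    qed
  qed
  with assms show ?thesis unfolding P_def by blast
qed

text \<open>Each reduction multiplies by \<open>lead_coeff g\<close> instead of dividing by it;
  \<open>c\<close> collects these factors.\<close>

lemma SX_pseudo_division:
  assumes "g \<in> SX" "g \<noteq> 0" "f \<in> SX"
  shows "\<exists>c q r. c \<in> S \<and> c \<noteq> 0 \<and> q \<in> SX \<and> r \<in> SX \<and> smult c f = g * q + r \<and>
    (r = 0 \<or> degree r < degree g)"
  using assms(3)
\<comment> \<open>The shift by \<open>Suc\<close> makes the passage from a nonzero constant to 0 a
  decrease.\<close>
proof (induction "if f = 0 then 0 else Suc (degree f)" arbitrary: f rule: less_induct)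
  case less
  show ?case
  proof (cases "f = 0 \<or> degree f < degree g")
    case True
    then show ?thesis using less.prems
      by (intro exI[of _ 1] exI[of _ 0] exI[of _ f]) (auto simp: S_1 SX_0)
  next
    case False
    \<comment> \<open>\<open>g * k\<close> has the same leading term as
      \<open>smult (lead_coeff g) f\<close>, so the top terms cancel.\<close>
    define k where "k = monom (lead_coeff f) (degree f - degree g)"
    define f' where "f' = smult (lead_coeff g) f - g * k"
    have kS: "k \<in> SX" and f'S: "f' \<in> SX"
      using less.prems assms(1) unfolding k_def f'_def
      by (auto intro!: SX_monom SX_diff SX_smult SX_mult SX_lead_coeff)
    have deg_gk: "degree (g * k) = degree f"
      using False assms(2) by (simp add: k_def degree_mult_eq degree_monom_eq)
    have "coeff f' (degree f) = 0"
    proof -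
      have "coeff (g * k) (degree f) = lead_coeff g * lead_coeff k"
        unfolding deg_gk[symmetric] by (rule lead_coeff_mult)
      also have "lead_coeff k = lead_coeff f"
        using False by (simp add: k_def degree_monom_eq)
      finally show ?thesis by (simp add: f'_def)
    qed
    moreover have "degree f' \<le> degree f"
      unfolding f'_def by (rule degree_diff_le) (simp_all add: deg_gk)
    ultimately have "f' = 0 \<or> degree f' < degree f"
      by (metis le_neq_implies_less leading_coeff_0_iff)
    then have "(if f' = 0 then 0 else Suc (degree f')) < (if f = 0 then 0 else Suc (degree f))"
      using False by auto
    from less.hyps[OF this f'S] obtain c q r where
      *: "c \<in> S" "c \<noteq> 0" "q \<in> SX" "r \<in> SX" "smult c f' = g * q + r" "r = 0 \<or> degree r < degree g"
      by blast
    have "smult (c * lead_coeff g) f = g * (q + smult c k) + r"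
    proof -
      have "smult (c * lead_coeff g) f = smult c f' + smult c (g * k)"
        by (simp add: f'_def smult_diff_right)
      then show ?thesis using *(5) by (simp add: algebra_simps)
    qed
    moreover have "c * lead_coeff g \<in> S" "c * lead_coeff g \<noteq> 0" "q + smult c k \<in> SX"
      using * kS assms by (auto intro!: S_mult SX_add SX_smult SX_lead_coeff)
    ultimately show ?thesis using * by blast
  qed
qed

text \<open>Cancelling \<open>c\<close> leaves \<open>Q = smult c1 Q'\<close> with \<open>Q'\<close>
  dividing \<open>F\<close>. Since \<open>Q'\<close> has positive degree, irreducibility makes
  \<open>c1\<close> a unit.\<close>

lemma SX_irreducible_dvd_smult:
  assumes Q: "Q \<in> SX" "degree Q > 0"
    and irr: "\<And>A B. A \<in> SX \<Longrightarrow> B \<in> SX \<Longrightarrow> Q = A * B \<Longrightarrow> A dvd 1 \<or> B dvd 1"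
    and F: "F \<in> SX" and c: "c \<in> S" "c \<noteq> 0" and K: "K \<in> SX" "smult c F = Q * K"
  shows "Q dvd F"
proof -
  obtain c1 c2 Q' K' where *: "c1 \<in> S" "Q' \<in> SX" "K' \<in> SX" "Q = smult c1 Q'" "F = Q' * K'"
    using gauss_strip[OF c F Q(1) K] by blast
  have "c1 \<noteq> 0" using * Q(2) by auto
  have "\<not> Q' dvd 1"
  proof
    assume "Q' dvd 1"
    then have "degree Q' = 0" by (auto simp: is_unit_poly_iff)
    then show False using * Q(2) by (simp split: if_splits)
  qed
  then have "[:c1:] dvd 1"
    using irr[OF SX_const *(2)] * by simp
  then have "Q dvd Q'"
    using *(4) by (intro dvd_mult_unitD[of "[:c1:]" Q Q']) simp_all
  then show ?thesis using * by simp
qed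

text \<open>An element \<open>D\<close> of least degree in the ideal of \<open>Q\<close> and
  \<open>F\<close> divides both up to nonzero constants. Either \<open>D\<close> is constant, or it
  is a constant multiple of an associate of \<open>Q\<close>.\<close>

lemma SX_dichotomy:
  assumes Q: "Q \<in> SX" "degree Q > 0"
    and irr: "\<And>A B. A \<in> SX \<Longrightarrow> B \<in> SX \<Longrightarrow> Q = A * B \<Longrightarrow> A dvd 1 \<or> B dvd 1"
    and F: "F \<in> SX"
  shows "Q dvd F \<or> (\<exists>c U W. c \<in> S \<and> c \<noteq> 0 \<and> U \<in> SX \<and> W \<in> SX \<and> [:c:] = U * Q + W * F)"
proof -
  define I where "I = {D. D \<noteq> 0 \<and> (\<exists>U\<in>SX. \<exists>W\<in>SX. D = U * Q + W * F)}"
  have "Q \<in> I"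
    unfolding I_def
  proof (intro CollectI conjI bexI)
    show "Q = [:1:] * Q + 0 * F" by simp
  qed (use Q SX_const[OF S_1] SX_0 in auto)
  then obtain D where D: "D \<in> I" and min: "\<And>E. E \<in> I \<Longrightarrow> degree D \<le> degree E"
    using ex_has_least_nat[of "\<lambda>D. D \<in> I" Q degree] by blast
  from D obtain U W where UW: "U \<in> SX" "W \<in> SX" "D = U * Q + W * F" and "D \<noteq> 0"
    by (auto simp: I_def)
  have DS: "D \<in> SX" using UW Q F by (auto intro: SX_add SX_mult)
  have D_dvd: "\<exists>c s. c \<in> S \<and> c \<noteq> 0 \<and> s \<in> SX \<and> smult c E = D * s"
    if E: "E \<in> SX" "U' \<in> SX" "W' \<in> SX" "E = U' * Q + W' * F" for E U' W'
  proof -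
    obtain c s r where *: "c \<in> S" "c \<noteq> 0" "s \<in> SX" "r \<in> SX" "smult c E = D * s + r"
      "r = 0 \<or> degree r < degree D"
      using SX_pseudo_division[OF DS \<open>D \<noteq> 0\<close> E(1)] by blast
    \<comment> \<open>The remainder lies in the ideal again, so minimality of
      \<open>degree D\<close> forces it to be 0.\<close>
    have "r = (smult c U' - U * s) * Q + (smult c W' - W * s) * F"
      using *(5) E(4) UW(3) by (simp add: algebra_simps smult_add_right)
    moreover have "smult c U' - U * s \<in> SX" "smult c W' - W * s \<in> SX"
      using * E UW by (auto intro: SX_diff SX_smult SX_mult)
    ultimately have "r \<noteq> 0 \<Longrightarrow> r \<in> I"
      unfolding I_def by blast
    then have "r = 0"
      using *(6) min[of r] by (meson not_le)
    with * show ?thesis by auto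
  qed
  show ?thesis
  proof (cases "degree D = 0")
    case True
    then obtain c where c: "D = [:c:]" by (rule degree_eq_zeroE)
    with SX_lead_coeff[OF DS] \<open>D \<noteq> 0\<close> have "c \<in> S" "c \<noteq> 0" by auto
    with UW c show ?thesis by metis
  next
    case False
    obtain c s where "c \<in> S" "c \<noteq> 0" "s \<in> SX" "smult c Q = D * s"
      using D_dvd[OF Q(1), of "[:1:]" 0] SX_const[OF S_1] SX_0 by auto
    then obtain c1 D' s' where *: "c1 \<in> S" "D' \<in> SX" "s' \<in> SX" "D = smult c1 D'" "Q = D' * s'"
      using gauss_strip[OF _ _ Q(1) DS] by blast
    have "\<not> D' dvd 1"
    proof
      assume "D' dvd 1"
      then have "degree D' = 0" by (auto simp: is_unit_poly_iff)
      then show False using * False by (simp split: if_splits)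
    qed
    then have "s' dvd 1" using irr * by blast
    obtain c' s2 where 2: "c' \<in> S" "c' \<noteq> 0" "s2 \<in> SX" "smult c' F = D * s2"
      using D_dvd[OF F, of 0 "[:1:]"] SX_const[OF S_1] SX_0 by auto
    \<comment> \<open>The unit \<open>s'\<close> is multiplied in so that \<open>D' * s' = Q\<close>
      appears; it is removed again at the end.\<close>
    have "smult c' (F * s') = smult c' F * s'" by simp
    also have "\<dots> = Q * smult c1 s2"
      unfolding 2(4) *(4) *(5) by (simp add: mult_ac)
    finally have "Q dvd F * s'"
      using SX_irreducible_dvd_smult[OF Q irr, of "F * s'" c' "smult c1 s2"] * 2 F
      by (auto intro: SX_mult SX_smult)
    then show ?thesis
      using \<open>s' dvd 1\<close> by (auto intro: dvd_mult_unitD)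
  qed
qed

end

section \<open>Polynomials as univariate polynomials in one of the variables\<close>

text \<open>The coefficients stay in the original type, so variables can be split off one after
  another inside a single ring.\<close>

definition as_poly :: "nat \<Rightarrow> ((nat \<Rightarrow>\<^sub>0 nat) \<Rightarrow>\<^sub>0 'a::comm_ring_1) \<Rightarrow> ((nat \<Rightarrow>\<^sub>0 nat) \<Rightarrow>\<^sub>0 'a) poly" where
  "as_poly v = mpoly_subst (\<lambda>a. [:Const a:]) (\<lambda>i. if i = v then [:0, 1:] else [:Var i:])"

lemma ring_map_const_Const: "ring_map (\<lambda>a. [:Const a:])"
  by (rule ring_map_comp[OF ring_map_const_poly ring_map_Const])

lemma ring_map_as_poly: "ring_map (as_poly v)"
  unfolding as_poly_def by (rule ring_map_mpoly_subst[OF ring_map_const_Const])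

lemmas as_poly_simps [simp] = ring_mapD[OF ring_map_as_poly]

lemma as_poly_Const [simp]: "as_poly v (Const a) = [:Const a:]"
  and as_poly_Var: "as_poly v (Var i) = (if i = v then [:0, 1:] else [:Var i:])"
  unfolding as_poly_def by (simp_all add: mpoly_subst_Const[OF ring_map_const_Const] mpoly_subst_Var[OF ring_map_const_Const])

lemma poly_as_poly: "poly (as_poly v p) (Var v) = p"
  by (rule ring_map_eqI[OF ring_map_comp[OF ring_map_poly ring_map_as_poly] ring_map_id])
     (simp_all add: as_poly_Var)

lemma as_poly_eq_0_iff [simp]: "as_poly v p = 0 \<longleftrightarrow> p = 0"
  using poly_as_poly[of v p] by auto

text \<open>Non-occurrence of \<open>v\<close>. Its description by degrees gives closure under
  factors, the one by \<open>kill\<close> closure under ring operations.\<close>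

definition free :: "nat \<Rightarrow> ((nat \<Rightarrow>\<^sub>0 nat) \<Rightarrow>\<^sub>0 'a::comm_ring_1) \<Rightarrow> bool" where
  "free v p \<longleftrightarrow> as_poly v p = [:p:]"

lemma free_iff_degree: "free v p \<longleftrightarrow> degree (as_poly v p) = 0"
proof
  assume "degree (as_poly v p) = 0"
  then obtain c where "as_poly v p = [:c:]" by (rule degree_eq_zeroE)
  then show "free v p" using poly_as_poly[of v p] by (simp add: free_def)
qed (simp add: free_def)

text \<open>Complements \<open>poly_as_poly\<close>: on polynomials with \<open>v\<close>-free
  coefficients the two maps are mutually inverse.\<close>

lemma as_poly_poly_Var:
  assumes "\<And>i. free v (coeff P i)"
  shows "as_poly v (poly P (Var v)) = P"
  using assms
proof (induction P)
  case (pCons a P)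
  have "free v a" using pCons.prems[of 0] by simp
  moreover have "as_poly v (poly P (Var v)) = P"
    using pCons.prems[of "Suc i" for i] pCons.IH by simp
  ultimately show ?case by (simp add: free_def as_poly_Var)
qed simp

definition kill :: "nat set \<Rightarrow> ((nat \<Rightarrow>\<^sub>0 nat) \<Rightarrow>\<^sub>0 'a::comm_ring_1) \<Rightarrow> ((nat \<Rightarrow>\<^sub>0 nat) \<Rightarrow>\<^sub>0 'a)" where
  "kill W = mpoly_subst Const (\<lambda>i. if i \<in> W then 0 else Var i)"

lemma ring_map_kill: "ring_map (kill W)"
  unfolding kill_def by (rule ring_map_mpoly_subst[OF ring_map_Const])

lemmas kill_simps [simp] = ring_mapD[OF ring_map_kill]

lemma kill_Const [simp]: "kill W (Const a) = Const a"
  and kill_Var: "kill W (Var i) = (if i \<in> W then 0 else Var i)"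
  unfolding kill_def by (simp_all add: mpoly_subst_Const[OF ring_map_Const] mpoly_subst_Var[OF ring_map_Const])

text \<open>Setting \<open>v\<close> to 0 amounts to evaluating \<open>as_poly v p\<close> at 0, and
  the result never contains \<open>v\<close>.\<close>

lemma free_iff_kill: "free v p \<longleftrightarrow> kill {v} p = p"
proof
  have "kill {v} p = poly (as_poly v p) 0"
    by (rule ring_map_eqI[OF ring_map_kill ring_map_comp[OF ring_map_poly ring_map_as_poly]])
       (simp_all add: as_poly_Var kill_Var)
  then show "free v p \<Longrightarrow> kill {v} p = p" by (simp add: free_def)
next
  have "as_poly v (kill {v} p) = [:kill {v} p:]"
    by (rule ring_map_eqI[OF ring_map_comp[OF ring_map_as_poly ring_map_kill]
          ring_map_comp[OF ring_map_const_poly ring_map_kill]])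
       (simp_all add: as_poly_Var kill_Var)
  then show "kill {v} p = p \<Longrightarrow> free v p" by (simp add: free_def)
qed

text \<open>Two homomorphisms are compared: for \<open>w = v\<close>, applying
  \<open>kill {v}\<close> to the coefficients changes nothing; otherwise killing \<open>w\<close>
  commutes with \<open>as_poly v\<close>.\<close>

lemma free_coeff_as_poly:
  assumes "w = v \<or> free w p"
  shows "free w (coeff (as_poly v p) i)"
proof -
  have "map_poly (kill {w}) (as_poly v p) = as_poly v p"
  proof (cases "w = v")
    case True
    show ?thesis unfolding True
      by (rule ring_map_eqI[OF ring_map_comp[OF ring_map_map_poly[OF ring_map_kill] ring_map_as_poly] ring_map_as_poly])
         (simp_all add: as_poly_Var kill_Var map_poly_pCons)
  next
    case False
    have "map_poly (kill {w}) (as_poly v p) = as_poly v (kill {w} p)"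
      by (rule ring_map_eqI[OF ring_map_comp[OF ring_map_map_poly[OF ring_map_kill] ring_map_as_poly]
            ring_map_comp[OF ring_map_as_poly ring_map_kill]])
         (use False in \<open>simp_all add: as_poly_Var kill_Var map_poly_pCons\<close>)
    with assms False show ?thesis by (simp add: free_iff_kill)
  qed
  then have "coeff (map_poly (kill {w}) (as_poly v p)) i = coeff (as_poly v p) i" by simp
  then show ?thesis by (simp add: free_iff_kill coeff_map_poly)
qed

lemma free_0 [simp]: "free v 0" and free_1 [simp]: "free v 1" and free_Const [simp]: "free v (Const a)"
  and free_Var: "i \<noteq> v \<Longrightarrow> free v (Var i)"
  and free_add: "free v p \<Longrightarrow> free v q \<Longrightarrow> free v (p + q)"
  and free_mult: "free v p \<Longrightarrow> free v q \<Longrightarrow> free v (p * q)"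
  and free_uminus: "free v p \<Longrightarrow> free v (- p)"
  by (simp_all add: free_iff_kill kill_Var ring_map_uminus[OF ring_map_kill])

text \<open>Degrees add over an integral domain; a zero product would say nothing about its
  factors.\<close>

lemma free_factor:
  fixes p q :: "(nat \<Rightarrow>\<^sub>0 nat) \<Rightarrow>\<^sub>0 'a::idom"
  assumes "free v (p * q)" "p * q \<noteq> 0"
  shows "free v p"
  using assms by (auto simp: free_iff_degree degree_mult_eq)

section \<open>Polynomials in a given set of variables\<close>

definition mpolys_in :: "nat set \<Rightarrow> ((nat \<Rightarrow>\<^sub>0 nat) \<Rightarrow>\<^sub>0 'a::comm_ring_1) set" where
  "mpolys_in V = {p. \<forall>v. v \<notin> V \<longrightarrow> free v p}"

lemma finite_variables: "\<exists>V. finite V \<and> p \<in> mpolys_in V"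
proof (induction p rule: mpoly_induct)
  case (Const a)
  show ?case by (intro exI[of _ "{}"]) (simp add: mpolys_in_def)
next
  case (Var i)
  show ?case by (intro exI[of _ "{i}"]) (auto simp: mpolys_in_def free_Var)
next
  case (add p q)
  then obtain V W where "finite V" "p \<in> mpolys_in V" "finite W" "q \<in> mpolys_in W" by blast
  then show ?case by (intro exI[of _ "V \<union> W"]) (auto simp: mpolys_in_def free_add)
next
  case (mult p q)
  then obtain V W where "finite V" "p \<in> mpolys_in V" "finite W" "q \<in> mpolys_in W" by blast
  then show ?case by (intro exI[of _ "V \<union> W"]) (auto simp: mpolys_in_def free_mult)
qed

text \<open>Quantifying over all larger \<open>W\<close> lets the union of two finite sets serve
  both operands of a sum or product.\<close>

lemma kill_cofinal_const: "\<exists>V. finite V \<and> (\<forall>W. V \<subseteq> W \<longrightarrow> (\<exists>a. kill W p = Const a))"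
proof (induction p rule: mpoly_induct)
  case (Const a)
  show ?case by (intro exI[of _ "{}"]) auto
next
  case (Var i)
  show ?case by (intro exI[of _ "{i}"]) (auto simp: kill_Var intro: exI[of _ 0] simp: ring_mapD[OF ring_map_Const])
next
  case (add p q)
  then obtain V V' where V: "finite V" "\<forall>W. V \<subseteq> W \<longrightarrow> (\<exists>a. kill W p = Const a)"
    "finite V'" "\<forall>W. V' \<subseteq> W \<longrightarrow> (\<exists>a. kill W q = Const a)" by blast
  have "\<exists>a. kill W (p + q) = Const a" if W: "V \<subseteq> W" "V' \<subseteq> W" for W
  proof -
    obtain a b where "kill W p = Const a" "kill W q = Const b"
      using V(2)[rule_format, OF W(1)] V(4)[rule_format, OF W(2)] by auto
    then have "kill W (p + q) = Const (a + b)" by (simp add: ring_mapD[OF ring_map_Const])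
    then show ?thesis by blast
  qed
  then show ?case
    using V(1,3) by (intro exI[of _ "V \<union> V'"]) simp
next
  case (mult p q)
  then obtain V V' where V: "finite V" "\<forall>W. V \<subseteq> W \<longrightarrow> (\<exists>a. kill W p = Const a)"
    "finite V'" "\<forall>W. V' \<subseteq> W \<longrightarrow> (\<exists>a. kill W q = Const a)" by blast
  have "\<exists>a. kill W (p * q) = Const a" if W: "V \<subseteq> W" "V' \<subseteq> W" for W
  proof -
    obtain a b where "kill W p = Const a" "kill W q = Const b"
      using V(2)[rule_format, OF W(1)] V(4)[rule_format, OF W(2)] by auto
    then have "kill W (p * q) = Const (a * b)" by (simp add: ring_mapD[OF ring_map_Const])
    then show ?thesis by blast
  qed
  then show ?case
    using V(1,3) by (intro exI[of _ "V \<union> V'"]) simp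
qed

text \<open>Setting variables to 0 leaves \<open>p\<close> fixed, as none occurs, yet a large enough
  finite set leaves only a constant.\<close>

lemma mpolys_in_empty:
  assumes "p \<in> mpolys_in {}"
  shows "\<exists>a. p = Const a"
proof -
  obtain V a where "finite V" "kill V p = Const a"
    using kill_cofinal_const[of p] by blast
  moreover have "kill V p = p" if "finite V" for V
    using that
  proof (induction V rule: finite_induct)
    case empty
    show ?case by (rule ring_map_eqI[OF ring_map_kill ring_map_id]) (simp_all add: kill_Var)
  next
    case (insert v V)
    have "kill (insert v V) p = kill {v} (kill V p)"
      by (rule ring_map_eqI[OF ring_map_kill ring_map_comp[OF ring_map_kill ring_map_kill]])
         (simp_all add: kill_Var)
    also have "\<dots> = p"
      using assms insert.IH by (simp add: mpolys_in_def free_iff_kill)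
    finally show ?case .
  qed
  ultimately show ?thesis by metis
qed

lemma mpolys_in_nonunit_degree:
  fixes p :: "(nat \<Rightarrow>\<^sub>0 nat) \<Rightarrow>\<^sub>0 'a::field"
  assumes "p \<in> mpolys_in V" "p \<noteq> 0" "\<not> p dvd 1"
  shows "\<exists>v\<in>V. degree (as_poly v p) > 0"
proof (rule ccontr)
  assume "\<not> ?thesis"
  with assms(1) have "p \<in> mpolys_in {}"
    by (auto simp: mpolys_in_def free_iff_degree)
  then obtain a where a: "p = Const a"
    using mpolys_in_empty by blast
  then have "a \<noteq> 0" using assms(2) by (auto simp: ring_mapD[OF ring_map_Const])
  then have "p * Const (1 / a) = 1"
    unfolding a by (simp flip: ring_mapD(4)[OF ring_map_Const]) (simp add: ring_mapD[OF ring_map_Const])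
  with assms(3) show False by (metis dvdI)
qed

lemma mpolys_in_factor:
  fixes p q :: "(nat \<Rightarrow>\<^sub>0 nat) \<Rightarrow>\<^sub>0 'a::idom"
  assumes "p * q \<in> mpolys_in V" "p * q \<noteq> 0"
  shows "p \<in> mpolys_in V" "q \<in> mpolys_in V"
  using assms free_factor[of _ p q] free_factor[of _ q p] by (auto simp: mpolys_in_def mult.commute)

text \<open>The sum of the degrees in the variables of \<open>V\<close> is additive, and positive
  for nonzero nonunits, so both factors of a proper factorization are smaller.\<close>

lemma mpoly_factor_induct [consumes 3, case_names unit irreducible mult]:
  fixes p :: "(nat \<Rightarrow>\<^sub>0 nat) \<Rightarrow>\<^sub>0 'a::field"
  assumes "finite V" "p \<in> mpolys_in V" "p \<noteq> 0"
    and unit: "\<And>u. u \<in> mpolys_in V \<Longrightarrow> u dvd 1 \<Longrightarrow> P u"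
    and irreducible: "\<And>q. q \<in> mpolys_in V \<Longrightarrow> irreducible q \<Longrightarrow> P q"
    and mult: "\<And>a b. a \<in> mpolys_in V \<Longrightarrow> b \<in> mpolys_in V \<Longrightarrow> P a \<Longrightarrow> P b \<Longrightarrow> P (a * b)"
  shows "P p"
  using assms(2,3)
proof (induction "\<Sum>v\<in>V. degree (as_poly v p)" arbitrary: p rule: less_induct)
  case less
  show ?case
  proof (cases "p dvd 1 \<or> irreducible p")
    case True
    then show ?thesis using unit[OF less.prems(1)] irreducible[OF less.prems(1)] by auto
  next
    case False
    then obtain a b where ab: "p = a * b" "\<not> a dvd 1" "\<not> b dvd 1"
      using less.prems by (auto simp: irreducible_def)
    then have nz: "a \<noteq> 0" "b \<noteq> 0" using less.prems by auto
    have V: "a \<in> mpolys_in V" "b \<in> mpolys_in V"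
      using mpolys_in_factor[of a b V] less.prems ab by auto
    have "(\<Sum>v\<in>V. degree (as_poly v p)) = (\<Sum>v\<in>V. degree (as_poly v a)) + (\<Sum>v\<in>V. degree (as_poly v b))"
      using nz by (simp add: ab degree_mult_eq sum.distrib)
    moreover have "(\<Sum>v\<in>V. degree (as_poly v a)) > 0" "(\<Sum>v\<in>V. degree (as_poly v b)) > 0"
      using mpolys_in_nonunit_degree[OF V(1) nz(1) ab(2)] mpolys_in_nonunit_degree[OF V(2) nz(2) ab(3)]
      by (auto simp: sum_nonneg_eq_0_iff \<open>finite V\<close> intro!: gr0I)
    ultimately have "P a" "P b"
      using V nz by (auto intro!: less.hyps)
    with V show ?thesis unfolding ab(1) by (intro mult)
  qed
qed

text \<open>Primality is a hypothesis so that the induction over variables can supply it for the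
  smaller set.\<close>

lemma gauss_subring_mpolys_in:
  assumes "finite V"
    and "\<And>q a b :: (nat \<Rightarrow>\<^sub>0 nat) \<Rightarrow>\<^sub>0 'a::field. q \<in> mpolys_in V \<Longrightarrow> irreducible q \<Longrightarrow>
      a \<in> mpolys_in V \<Longrightarrow> b \<in> mpolys_in V \<Longrightarrow> q dvd a * b \<Longrightarrow> q dvd a \<or> q dvd b"
  shows "gauss_subring (mpolys_in V :: ((nat \<Rightarrow>\<^sub>0 nat) \<Rightarrow>\<^sub>0 'a) set)"
proof
  fix P :: "((nat \<Rightarrow>\<^sub>0 nat) \<Rightarrow>\<^sub>0 'a) \<Rightarrow> bool" and c :: "(nat \<Rightarrow>\<^sub>0 nat) \<Rightarrow>\<^sub>0 'a"
  assume "c \<in> mpolys_in V" "c \<noteq> 0" "\<And>u. u \<in> mpolys_in V \<Longrightarrow> u dvd 1 \<Longrightarrow> P u"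
    "\<And>q. q \<in> mpolys_in V \<Longrightarrow> irreducible q \<Longrightarrow> P q"
    "\<And>a b. a \<in> mpolys_in V \<Longrightarrow> b \<in> mpolys_in V \<Longrightarrow> P a \<Longrightarrow> P b \<Longrightarrow> P (a * b)"
  then show "P c" by (rule mpoly_factor_induct[OF assms(1)])
next
  show "a \<in> mpolys_in V" if "a * b \<in> mpolys_in V" "a * b \<noteq> 0" for a b :: "(nat \<Rightarrow>\<^sub>0 nat) \<Rightarrow>\<^sub>0 'a"
    using mpolys_in_factor(1)[OF that] .
qed (simp_all add: assms(2), simp_all add: mpolys_in_def free_add free_mult free_uminus)

section \<open>Irreducible polynomials are prime\<close>

text \<open>The values of \<open>A\<close> and \<open>B\<close> at \<open>Var v\<close> factor
  \<open>q\<close>, so one is a unit; \<open>as_poly v\<close> maps it back to \<open>A\<close> or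
  \<open>B\<close>.\<close>

lemma as_poly_irreducible:
  assumes "irreducible q" "as_poly v q = A * B"
    and "\<And>i. free v (coeff A i)" "\<And>i. free v (coeff B i)"
  shows "A dvd 1 \<or> B dvd 1"
proof -
  have "q = poly A (Var v) * poly B (Var v)"
    using poly_as_poly[of v q] assms(2) by simp
  then have "poly A (Var v) dvd 1 \<or> poly B (Var v) dvd 1"
    using assms(1) by (auto simp: irreducible_def)
  then have "as_poly v (poly A (Var v)) dvd as_poly v 1 \<or> as_poly v (poly B (Var v)) dvd as_poly v 1"
    using ring_map_dvd[OF ring_map_as_poly] by blast
  then show ?thesis using assms(3,4) by (simp add: as_poly_poly_Var)
qed

lemma dvd_of_as_poly_dvd:
  assumes "as_poly v p dvd as_poly v q"
  shows "p dvd q"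
  using ring_map_dvd[OF ring_map_poly[of "Var v"] assms] by (simp add: poly_as_poly)

lemma coeff_as_poly_mpolys_in:
  assumes "p \<in> mpolys_in (insert v V)"
  shows "coeff (as_poly v p) i \<in> mpolys_in V"
  using assms free_coeff_as_poly[of _ v p i] by (auto simp: mpolys_in_def)

text \<open>A variable \<open>v\<close> is split off. If \<open>q\<close> lacks it, \<open>q\<close>
  becomes a constant and Gauss's argument on coefficients applies; otherwise
  \<open>SX_dichotomy\<close> is applied to \<open>q\<close> and \<open>a\<close>.\<close>

lemma irreducible_dvd_mult_mpolys_in:
  fixes q a b :: "(nat \<Rightarrow>\<^sub>0 nat) \<Rightarrow>\<^sub>0 'a::field"
  assumes "finite V" "q \<in> mpolys_in V" "irreducible q" "a \<in> mpolys_in V" "b \<in> mpolys_in V"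
    "q dvd a * b"
  shows "q dvd a \<or> q dvd b"
  using assms
proof (induction V arbitrary: q a b rule: finite_induct)
  case empty
  \<comment> \<open>Without variables every polynomial is 0 or a unit, so none is
    irreducible.\<close>
  then show ?case
    using mpolys_in_nonunit_degree[of q "{}"] by (auto simp: irreducible_def)
next
  case (insert v V)
  interpret gauss_subring "mpolys_in V :: ((nat \<Rightarrow>\<^sub>0 nat) \<Rightarrow>\<^sub>0 'a) set"
    using insert.hyps(1) insert.IH by (rule gauss_subring_mpolys_in)
  have SX: "as_poly v p \<in> SX" if "p \<in> mpolys_in (insert v V)" for p :: "(nat \<Rightarrow>\<^sub>0 nat) \<Rightarrow>\<^sub>0 'a"
    using coeff_as_poly_mpolys_in[OF that] by (simp add: SX_def)
  have free: "free v (coeff P i)" if "P \<in> SX" for P i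
  proof -
    have "coeff P i \<in> mpolys_in V" using that by (simp add: SX_def)
    then show ?thesis using insert.hyps(2) by (simp add: mpolys_in_def)
  qed
  have irr: "A dvd 1 \<or> B dvd 1" if "A \<in> SX" "B \<in> SX" "as_poly v q = A * B" for A B
    using as_poly_irreducible[OF insert.prems(2) that(3) free[OF that(1)] free[OF that(2)]] .
  obtain k where k: "a * b = q * k"
    using insert.prems by (elim dvdE)
  show ?case
  proof (cases "a * b = 0")
    case True
    then show ?thesis by auto
  next
    case False
    have "a * b \<in> mpolys_in (insert v V)"
      using insert.prems(3,4) by (simp add: mpolys_in_def free_mult)
    then have kV: "k \<in> mpolys_in (insert v V)"
      using mpolys_in_factor(2)[of q k] k False by simp
    show ?thesis
    proof (cases "degree (as_poly v q) = 0")
      case True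
      then have "free v q" by (simp add: free_iff_degree)
      then have q: "q \<in> mpolys_in V" "as_poly v q = [:q:]"
        using insert.prems(1) by (auto simp: mpolys_in_def free_def)
      have "[:q:] dvd as_poly v a * as_poly v b"
        using arg_cong[OF k, of "as_poly v"] q by (metis dvdI as_poly_simps(4))
      then show ?thesis
        using irreducible_dvd_SX_mult[OF q(1) insert.prems(2) SX[OF insert.prems(3)] SX[OF insert.prems(4)]]
          dvd_of_as_poly_dvd[of v q] q(2) by auto
    next
      case False
      then have deg: "degree (as_poly v q) > 0" by simp
      consider "as_poly v q dvd as_poly v a"
        | c U W where "c \<in> mpolys_in V" "c \<noteq> 0" "U \<in> SX" "W \<in> SX"
          "[:c:] = U * as_poly v q + W * as_poly v a"
        using SX_dichotomy[OF SX[OF insert.prems(1)] deg irr SX[OF insert.prems(3)]] by blast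
      then show ?thesis
      proof cases
        case 1
        then show ?thesis using dvd_of_as_poly_dvd by blast
      next
        case (2 c U W)
        \<comment> \<open>Multiplying the Bezout relation by \<open>b\<close> and using
          \<open>a * b = q * k\<close> makes \<open>c * b\<close> a multiple of \<open>q\<close>;
          then \<open>c\<close> is cancelled.\<close>
        have "smult c (as_poly v b) = [:c:] * as_poly v b" by simp
        also have "\<dots> = U * as_poly v q * as_poly v b + W * (as_poly v (a * b))"
          unfolding 2(5) by (simp add: algebra_simps)
        also have "\<dots> = as_poly v q * (U * as_poly v b + W * as_poly v k)"
          unfolding k by (simp add: algebra_simps)
        finally have eq: "smult c (as_poly v b) = as_poly v q * (U * as_poly v b + W * as_poly v k)" .
        have "U * as_poly v b + W * as_poly v k \<in> SX"
          by (intro SX_add SX_mult 2 SX insert.prems kV)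
        from SX_irreducible_dvd_smult[OF SX[OF insert.prems(1)] deg irr SX[OF insert.prems(4)] 2(1,2) this eq]
        have "as_poly v q dvd as_poly v b" .
        then show ?thesis using dvd_of_as_poly_dvd by blast
      qed
    qed
  qed
qed

lemma gauss_subring_mpolys_in_field:
  "finite V \<Longrightarrow> gauss_subring (mpolys_in V :: ((nat \<Rightarrow>\<^sub>0 nat) \<Rightarrow>\<^sub>0 'a::field) set)"
  by (intro gauss_subring_mpolys_in irreducible_dvd_mult_mpolys_in)

lemma irreducible_dvd_mult:
  fixes q a b :: "(nat \<Rightarrow>\<^sub>0 nat) \<Rightarrow>\<^sub>0 'a::field"
  assumes "irreducible q" "q dvd a * b"
  shows "q dvd a \<or> q dvd b"
proof -
  obtain V1 V2 V3 where V: "finite V1" "q \<in> mpolys_in V1" "finite V2" "a \<in> mpolys_in V2"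
    "finite V3" "b \<in> mpolys_in V3"
    using finite_variables by meson
  then have "q \<in> mpolys_in (V1 \<union> V2 \<union> V3)" "a \<in> mpolys_in (V1 \<union> V2 \<union> V3)" "b \<in> mpolys_in (V1 \<union> V2 \<union> V3)"
    by (auto simp: mpolys_in_def)
  with V assms show ?thesis
    using irreducible_dvd_mult_mpolys_in[of "V1 \<union> V2 \<union> V3"] by auto
qed

section \<open>The Nullstellensatz for hypersurfaces\<close>

definition eval_at :: "(nat \<Rightarrow> 'a) \<Rightarrow> ((nat \<Rightarrow>\<^sub>0 nat) \<Rightarrow>\<^sub>0 'a::comm_ring_1) \<Rightarrow> 'a" where
  "eval_at b = mpoly_subst (\<lambda>x. x) b"

lemma ring_map_eval_at: "ring_map (eval_at b)"
  unfolding eval_at_def by (rule ring_map_mpoly_subst[OF ring_map_id])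

lemmas eval_at_simps [simp] = ring_mapD[OF ring_map_eval_at]

lemma eval_at_Const [simp]: "eval_at b (Const a) = a"
  and eval_at_Var [simp]: "eval_at b (Var i) = b i"
  unfolding eval_at_def by (simp_all add: mpoly_subst_Const[OF ring_map_id] mpoly_subst_Var[OF ring_map_id])

text \<open>Allows a point to be moved along the coordinate \<open>v\<close> while the coefficients
  keep their values at \<open>b\<close>.\<close>

lemma eval_at_update:
  "eval_at (b(v := t)) p = poly (map_poly (eval_at b) (as_poly v p)) t"
  by (rule ring_map_eqI[OF ring_map_eval_at ring_map_comp[OF ring_map_poly
        ring_map_comp[OF ring_map_map_poly[OF ring_map_eval_at] ring_map_as_poly]]])
     (simp_all add: as_poly_Var map_poly_pCons)

text \<open>Otherwise the product of all \<open>[:- a, 1:]\<close>, plus 1, would be nonconstant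
  without roots.\<close>

lemma infinite_UNIV_alg_closed_field: "infinite (UNIV :: 'a::alg_closed_field set)"
proof
  assume fin: "finite (UNIV :: 'a set)"
  define p :: "'a poly" where "p = (\<Prod>a\<in>UNIV. [:- a, 1:]) + 1"
  have "degree (\<Prod>a\<in>(UNIV::'a set). [:- a, 1:]) = card (UNIV :: 'a set)"
    by (subst degree_prod_eq_sum_degree) auto
  moreover have "card (UNIV :: 'a set) > 0" using fin by (simp add: card_gt_0_iff)
  ultimately have "degree p > 0"
    unfolding p_def by (subst degree_add_eq_left) auto
  then obtain x where "poly p x = 0" using alg_closed_imp_poly_has_root by blast
  moreover have "poly (\<Prod>a\<in>(UNIV::'a set). [:- a, 1:]) x = 0"
    using fin by (auto simp: poly_prod intro!: prod_zero)
  ultimately show False by (simp add: p_def)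
qed

text \<open>By induction the leading coefficient in \<open>v\<close> is nonzero at some point; the
  infinite field then has a value for \<open>v\<close> outside the finitely many roots.\<close>

lemma eval_at_nonzero:
  fixes p :: "(nat \<Rightarrow>\<^sub>0 nat) \<Rightarrow>\<^sub>0 'a::alg_closed_field"
  assumes "p \<noteq> 0"
  shows "\<exists>b. eval_at b p \<noteq> 0"
proof -
  obtain V where "finite V" "p \<in> mpolys_in V"
    using finite_variables by blast
  then show ?thesis
    using assms
  proof (induction V arbitrary: p rule: finite_induct)
    case empty
    then obtain a where "p = Const a" using mpolys_in_empty by blast
    with empty show ?case by (auto simp: ring_mapD[OF ring_map_Const])
  next
    case (insert v V)
    define P where "P = as_poly v p"
    have "lead_coeff P \<in> mpolys_in V" "lead_coeff P \<noteq> 0"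
      using insert.prems unfolding P_def by (simp_all add: coeff_as_poly_mpolys_in)
    then obtain b where b: "eval_at b (lead_coeff P) \<noteq> 0"
      using insert.IH by blast
    then have "map_poly (eval_at b) P \<noteq> 0"
      by (metis coeff_0 coeff_map_poly eval_at_simps(1))
    then have "finite {t. poly (map_poly (eval_at b) P) t = 0}"
      by (rule poly_roots_finite)
    then obtain t where "poly (map_poly (eval_at b) P) t \<noteq> 0"
      using infinite_UNIV_alg_closed_field[where 'a='a] by (metis (mono_tags, lifting) Collect_cong UNIV_def)
    then show ?case unfolding P_def eval_at_update[symmetric] by blast
  qed
qed

lemma irreducible_dvd_if_vanishing:
  fixes q f :: "(nat \<Rightarrow>\<^sub>0 nat) \<Rightarrow>\<^sub>0 'a::alg_closed_field"
  assumes q: "irreducible q" and vanish: "\<And>b. eval_at b q = 0 \<Longrightarrow> eval_at b f = 0"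
  shows "q dvd f"
proof -
  obtain V1 V2 where V12: "finite V1" "q \<in> mpolys_in V1" "finite V2" "f \<in> mpolys_in V2"
    using finite_variables by meson
  obtain v where v: "v \<in> V1" "degree (as_poly v q) > 0"
    using mpolys_in_nonunit_degree[OF V12(2)] q by (auto simp: irreducible_def)
  define V where "V = V1 \<union> V2 - {v}"
  have V: "finite V" "q \<in> mpolys_in (insert v V)" "f \<in> mpolys_in (insert v V)" "v \<notin> V"
    using V12 v by (auto simp: V_def mpolys_in_def)
  interpret gauss_subring "mpolys_in V :: ((nat \<Rightarrow>\<^sub>0 nat) \<Rightarrow>\<^sub>0 'a) set"
    using V(1) by (rule gauss_subring_mpolys_in_field)
  have SX: "as_poly v p \<in> SX" if "p \<in> mpolys_in (insert v V)" for p :: "(nat \<Rightarrow>\<^sub>0 nat) \<Rightarrow>\<^sub>0 'a"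
    using coeff_as_poly_mpolys_in[OF that] by (simp add: SX_def)
  have free: "free v (coeff P i)" if "P \<in> SX" for P i
  proof -
    have "coeff P i \<in> mpolys_in V" using that by (simp add: SX_def)
    then show ?thesis using V(4) by (simp add: mpolys_in_def)
  qed
  have irr: "A dvd 1 \<or> B dvd 1" if "A \<in> SX" "B \<in> SX" "as_poly v q = A * B" for A B
    using as_poly_irreducible[OF q that(3) free[OF that(1)] free[OF that(2)]] .
  consider "as_poly v q dvd as_poly v f"
    | c U W where "c \<noteq> 0" "[:c:] = U * as_poly v q + W * as_poly v f"
    using SX_dichotomy[OF SX[OF V(2)] v(2) irr SX[OF V(3)]] by blast
  then show ?thesis
  proof cases
    case 1
    then show ?thesis by (rule dvd_of_as_poly_dvd)
  next
    case (2 c U W)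
    define Q where "Q = as_poly v q"
    \<comment> \<open>The product yields one point at which both factors are nonzero.\<close>
    have "c * lead_coeff Q \<noteq> 0"
      using 2 v by (auto simp: Q_def)
    then obtain b where "eval_at b (c * lead_coeff Q) \<noteq> 0"
      using eval_at_nonzero by blast
    then have b: "eval_at b c \<noteq> 0" "eval_at b (lead_coeff Q) \<noteq> 0"
      by auto
    \<comment> \<open>The leading coefficient survives evaluation, so the degree stays positive and
      a root exists.\<close>
    then have "degree (map_poly (eval_at b) Q) > 0"
      using v by (simp add: Q_def map_poly_degree_eq)
    then obtain t where t: "poly (map_poly (eval_at b) Q) t = 0"
      using alg_closed_imp_poly_has_root by blast
    then have "eval_at (b(v := t)) q = 0"
      by (simp add: eval_at_update Q_def)
    then have "poly (map_poly (eval_at b) (as_poly v f)) t = 0"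
      using vanish by (simp flip: eval_at_update)
    \<comment> \<open>Both generators vanish at \<open>t\<close>, hence so does their combination,
      whose value is \<open>eval_at b c\<close> for every \<open>t\<close>.\<close>
    with t have "poly (map_poly (eval_at b) (U * as_poly v q + W * as_poly v f)) t = 0"
      by (simp add: ring_mapD[OF ring_map_map_poly[OF ring_map_eval_at]] Q_def)
    then have "eval_at b c = 0"
      unfolding 2(2)[symmetric] by (simp add: map_poly_pCons)
    with b show ?thesis by simp
  qed
qed

text \<open>\<open>h\<close> is assembled along a factorization of \<open>p\<close> into
  irreducibles. That its zeros are zeros of \<open>p\<close> follows from
  \<open>h dvd p\<close>.\<close>

lemma common_divisor_same_zeros:
  fixes p g :: "(nat \<Rightarrow>\<^sub>0 nat) \<Rightarrow>\<^sub>0 'a::alg_closed_field"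
  assumes "\<And>b. eval_at b p = 0 \<Longrightarrow> eval_at b g = 0"
  shows "\<exists>h. h dvd p \<and> h dvd g \<and> (\<forall>b. eval_at b p = 0 \<longrightarrow> eval_at b h = 0)"
proof (cases "p = 0")
  case True
  then have "g = 0" using assms eval_at_nonzero[of g] by auto
  with True show ?thesis by (intro exI[of _ 0]) auto
next
  case False
  \<comment> \<open>A factor \<open>a\<close> of \<open>p\<close> may be absorbed into any partial solution \<open>h\<close>; since irreducibles are
    prime, an irreducible factor divides \<open>h\<close> or the cofactor \<open>g / h\<close>.\<close>
  define extends where "extends a \<longleftrightarrow> ((\<forall>b. eval_at b a = 0 \<longrightarrow> eval_at b g = 0) \<longrightarrow>
    (\<forall>c h. h dvd c \<and> h dvd g \<and> (\<forall>b. eval_at b c = 0 \<longrightarrow> eval_at b h = 0) \<longrightarrow>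
      (\<exists>h'. h' dvd a * c \<and> h' dvd g \<and> (\<forall>b. eval_at b (a * c) = 0 \<longrightarrow> eval_at b h' = 0))))" for a
  have extendsD: "\<exists>h'. h' dvd a * c \<and> h' dvd g \<and> (\<forall>b. eval_at b (a * c) = 0 \<longrightarrow> eval_at b h' = 0)"
    if "extends a" "\<forall>b. eval_at b a = 0 \<longrightarrow> eval_at b g = 0"
      "h dvd c \<and> h dvd g \<and> (\<forall>b. eval_at b c = 0 \<longrightarrow> eval_at b h = 0)" for a c h
    using that(1)[unfolded extends_def, THEN mp, OF that(2), rule_format, OF that(3)] .
  obtain V where "finite V" "p \<in> mpolys_in V"
    using finite_variables by blast
  then have "extends p"
    using False
  proof (induction rule: mpoly_factor_induct)
    case (unit u)
    then obtain w where w: "1 = u * w" by (elim dvdE)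
    \<comment> \<open>A unit has no zeros, so the given \<open>h\<close> still works.\<close>
    have "eval_at b u \<noteq> 0" for b
      using arg_cong[OF w, of "eval_at b"] by auto
    then show ?case unfolding extends_def by (auto intro: dvd_mult)
  next
    case (irreducible q)
    show ?case
      unfolding extends_def
    proof (intro impI allI, elim conjE)
      fix c h assume vanish: "\<forall>b. eval_at b q = 0 \<longrightarrow> eval_at b g = 0"
        and h: "h dvd c" "h dvd g" "\<forall>b. eval_at b c = 0 \<longrightarrow> eval_at b h = 0"
      obtain k where k: "g = h * k" using h(2) by (elim dvdE)
      have "q dvd h * k"
        using irreducible_dvd_if_vanishing[OF irreducible(2)] vanish k by blast
      then consider "q dvd h" | "q dvd k"
        using irreducible_dvd_mult[OF irreducible(2)] by blast
      then show "\<exists>h'. h' dvd q * c \<and> h' dvd g \<and> (\<forall>b. eval_at b (q * c) = 0 \<longrightarrow> eval_at b h' = 0)"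
      proof cases
        case 1
        then have "eval_at b h = 0" if "eval_at b q = 0" for b
          using that by (auto elim!: dvdE)
        then show ?thesis using h by (intro exI[of _ h]) auto
      next
        case 2
        then have "q * h dvd g" unfolding k by (auto elim!: dvdE)
        then show ?thesis using h by (intro exI[of _ "q * h"]) (auto intro: mult_dvd_mono)
      qed
    qed
  next
    case (mult a1 a2)
    show ?case
      unfolding extends_def
    proof (intro impI allI)
      fix c h assume vanish: "\<forall>b. eval_at b (a1 * a2) = 0 \<longrightarrow> eval_at b g = 0"
        and h: "h dvd c \<and> h dvd g \<and> (\<forall>b. eval_at b c = 0 \<longrightarrow> eval_at b h = 0)"
      have vanish1: "\<forall>b. eval_at b a1 = 0 \<longrightarrow> eval_at b g = 0"
        and vanish2: "\<forall>b. eval_at b a2 = 0 \<longrightarrow> eval_at b g = 0"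
        using vanish by auto
      \<comment> \<open>First \<open>a2\<close> is absorbed into \<open>h\<close>, then
        \<open>a1\<close> into the result.\<close>
      obtain h2 where "h2 dvd a2 * c \<and> h2 dvd g \<and> (\<forall>b. eval_at b (a2 * c) = 0 \<longrightarrow> eval_at b h2 = 0)"
        using extendsD[OF mult(4) vanish2 h] by blast
      from extendsD[OF mult(3) vanish1 this]
      obtain h1 where "h1 dvd a1 * (a2 * c) \<and> h1 dvd g \<and>
          (\<forall>b. eval_at b (a1 * (a2 * c)) = 0 \<longrightarrow> eval_at b h1 = 0)"
        by blast
      then show "\<exists>h'. h' dvd a1 * a2 * c \<and> h' dvd g \<and> (\<forall>b. eval_at b (a1 * a2 * c) = 0 \<longrightarrow> eval_at b h' = 0)"
        by (metis mult.assoc)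
    qed
  qed
  then show ?thesis
    \<comment> \<open>All of \<open>p\<close> is absorbed into the trivial solution
      \<open>h = 1\<close> for \<open>c = 1\<close>.\<close>
    using extendsD[of p 1 1] assms by auto
qed

section \<open>Transfer from arbitrary finite sets of variables\<close>

lemma mpoly_eval_eq_subst: "mpoly_eval p a = mpoly_subst (\<lambda>x. x) (\<lambda>i. a $ i) p"
  unfolding mpoly_eval_def mpoly_subst_def
  by (intro sum.cong refl arg_cong2[of _ _ _ _ "(*)"] prod.mono_neutral_right)
     (auto simp: not_in_keys_iff_lookup_eq_zero)

lemma ring_map_mpoly_eval: "ring_map (\<lambda>p. mpoly_eval p a)"
  unfolding mpoly_eval_eq_subst by (rule ring_map_mpoly_subst[OF ring_map_id])

lemma mpoly_eval_Const [simp]: "mpoly_eval (Const x) a = x"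
  and mpoly_eval_Var [simp]: "mpoly_eval (Var i) a = a $ i"
  unfolding mpoly_eval_eq_subst
  by (simp_all add: mpoly_subst_Const[OF ring_map_id] mpoly_subst_Var[OF ring_map_id])

theorem theorem1:
  fixes p g :: "('a::alg_closed_field, 'n::finite) mpoly"
  assumes "zero_set p = zero_set g"
  shows "\<exists>h :: ('a, 'n) mpoly. h dvd p \<and> h dvd g \<and> zero_set h = zero_set p \<and> zero_set h = zero_set g"
proof -
  obtain e :: "'n \<Rightarrow> nat" where "inj e"
    using finite_imp_inj_to_nat_seg[of "UNIV :: 'n set"] by auto
  \<comment> \<open>Variables are renamed into \<open>nat\<close> and back. Outside the range of
    \<open>e\<close> the values of \<open>inv e\<close> are arbitrary; only
    \<open>inv e (e i) = i\<close> matters.\<close>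
  define up :: "('a, 'n) mpoly \<Rightarrow> (nat \<Rightarrow>\<^sub>0 nat) \<Rightarrow>\<^sub>0 'a" where "up = mpoly_subst Const (\<lambda>i. Var (e i))"
  define down :: "((nat \<Rightarrow>\<^sub>0 nat) \<Rightarrow>\<^sub>0 'a) \<Rightarrow> ('a, 'n) mpoly" where "down = mpoly_subst Const (\<lambda>j. Var (inv e j))"
  have up: "ring_map up" "\<And>a. up (Const a) = Const a" "\<And>i. up (Var i) = Var (e i)"
    unfolding up_def by (simp_all add: ring_map_mpoly_subst mpoly_subst_Const mpoly_subst_Var ring_map_Const)
  have down: "ring_map down" "\<And>a. down (Const a) = Const a" "\<And>i. down (Var i) = Var (inv e i)"
    unfolding down_def by (simp_all add: ring_map_mpoly_subst mpoly_subst_Const mpoly_subst_Var ring_map_Const)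
  have down_up: "down (up f) = f" for f
    by (rule ring_map_eqI[OF ring_map_comp[OF down(1) up(1)] ring_map_id])
       (simp_all add: up down \<open>inj e\<close>)
  have eval_up: "eval_at b (up f) = mpoly_eval f (\<chi> i. b (e i))" for b f
    by (rule ring_map_eqI[OF ring_map_comp[OF ring_map_eval_at up(1)] ring_map_mpoly_eval])
       (simp_all add: up)
  have eval_down: "mpoly_eval (down f) a = eval_at (\<lambda>j. a $ inv e j) f" for a f
    by (rule ring_map_eqI[OF ring_map_comp[OF ring_map_mpoly_eval down(1)] ring_map_eval_at])
       (simp_all add: down)
  have same: "mpoly_eval p a = 0 \<longleftrightarrow> mpoly_eval g a = 0" for a
    using assms by (auto simp: zero_set_def)
  then obtain h where h: "h dvd up p" "h dvd up g" "\<And>b. eval_at b (up p) = 0 \<Longrightarrow> eval_at b h = 0"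
    using common_divisor_same_zeros[of "up p" "up g"] by (auto simp: eval_up)
  have dvd: "down h dvd p" "down h dvd g"
    using ring_map_dvd[OF down(1) h(1)] ring_map_dvd[OF down(1) h(2)] by (simp_all add: down_up)
  have "mpoly_eval (down h) a = 0 \<longleftrightarrow> mpoly_eval p a = 0" for a
  proof
    show "mpoly_eval (down h) a = 0 \<Longrightarrow> mpoly_eval p a = 0"
      using ring_map_dvd[OF ring_map_mpoly_eval[of a] dvd(1)] by simp
    \<comment> \<open>At the point with coordinates \<open>a $ inv e j\<close>, \<open>up p\<close>
      takes the value of \<open>p\<close> at \<open>a\<close>, so \<open>h\<close> vanishes there if
      \<open>p\<close> vanishes at \<open>a\<close>.\<close>
    have "(\<chi> i. a $ inv e (e i)) = a" using \<open>inj e\<close> by (simp add: vec_eq_iff)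
    then show "mpoly_eval p a = 0 \<Longrightarrow> mpoly_eval (down h) a = 0"
      unfolding eval_down by (intro h(3)) (simp add: eval_up)
  qed
  then have "zero_set (down h) = zero_set p" by (simp add: zero_set_def)
  with dvd assms show ?thesis by blast
qed

end
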